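(* Let $R$ be a ring, let $\mathcal{P}$ be an $m$-gon with $m\ge 3$, and let $c:\mathrm{diag}(\mathcal{P})\to R^{\ast}$ be a noncommutative frieze on $\mathcal{P}$ over $R$ (i.e. $c$ satisfies all local triangle relations and all local noncommutative exchange relations). Then $c$ satisfies all triangle relations, i.e. for all distinct vertices $i,j,k$ of $\mathcal{P}$ $$c_{i,j}c_{k,j}^{-1}c_{k,i} = c_{i,k}c_{j,k}^{-1}c_{j,i},$$ and all noncommutative exchange relations, i.e. for all quadruples of distinct vertices $i,j,k,\ell$ of $\mathcal{P}$ such that $(i,k)$ and $(j,\ell)$ are the (crossing) diagonals of the quadrangle spanned by $i,j,k,\ell$, $$c_{k,i} = c_{k,\ell}c_{j,\ell}^{-1}c_{j,i}+ c_{k,j} c_{\ell,j}^{-1}c_{\ell,i}.$$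
   Context: $R$ is an associative unital, not necessarily commutative, ring and $R^{\ast}$ is its group of invertible elements. $\mathcal{P}$ is an $m$-gon with vertices numbered consecutively $0,1,\dots,m-1$; vertex indices are taken modulo $m$. $\mathrm{diag}(\mathcal{P})$ is the set of directed diagonals, one from $i$ to $j$ and one from $j$ to $i$ for each pair of distinct vertices (edges of the polygon are included). For a map $c:\mathrm{diag}(\mathcal{P})\to R^{\ast}$, write $c_{i,j}$ for the value on the directed diagonal from $i$ to $j$; in general $c_{i,j}\ne c_{j,i}$. Local triangle relation for three consecutive vertices $i,i+1,i+2$: $$c_{i+1,i+2}c_{i,i+2}^{-1}c_{i,i+1} = c_{i+1,i}c_{i+2,i}^{-1}c_{i+2,i+1}.$$ Local noncommutative exchange relations for a quadrangle with (four distinct) vertices $i,i+1,j,j+1$ (one for each directed diagonal): $$c_{j,i} = c_{j,j+1}c_{i+1,j+1}^{-1}c_{i+1,i} + c_{j,i+1} c_{j+1,i+1}^{-1}c_{j+1,i},$$ $$c_{i,j} = c_{i,i+1}c_{j+1,i+1}^{-1}c_{j+1,j} + c_{i,j+1} c_{i+1,j+1}^{-1}c_{i+1,j},$$ $$c_{i+1,j+1} = c_{i+1,i}c_{j,i}^{-1}c_{j,j+1} + c_{i+1,j} c_{i,j}^{-1}c_{i,j+1},$$ $$c_{j+1,i+1} = c_{j+1,j}c_{i,j}^{-1}c_{i,i+1} + c_{j+1,i} c_{j,i}^{-1}c_{j,i+1}.$$ A noncommutative frieze on $\mathcal{P}$ over $R$ is a map $c:\mathrm{diag}(\mathcal{P})\to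 R^{\ast}$ satisfying all local triangle relations and all local noncommutative exchange relations. *)

theory Defs
  imports "HOL-Algebra.Ring" "HOL-Library.FuncSet"
begin

text \<open>The vertices of the \<open>m\<close>-gon are the numbers \<open>0, \<dots>, m - 1\<close> in cyclic order;
  the neighbour of \<open>i\<close> is \<open>(i + 1) mod m\<close>. Edges count as diagonals.\<close>

definition diag :: "nat \<Rightarrow> (nat \<times> nat) set" where
  "diag m = {(i, j). i < m \<and> j < m \<and> i \<noteq> j}"

text \<open>In the next two definitions the arguments \<open>i1, i2, j1\<close> stand for the vertices
  \<open>i + 1, i + 2, j + 1\<close> modulo \<open>m\<close>.\<close>

definition local_triangle_relation ::
    "('a, 'b) ring_scheme \<Rightarrow> (nat \<times> nat \<Rightarrow> 'a) \<Rightarrow> nat \<Rightarrow> nat \<Rightarrow> nat \<Rightarrow> bool" where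
  "local_triangle_relation R c i i1 i2 \<longleftrightarrow>
     c (i1, i2) \<otimes>\<^bsub>R\<^esub> inv\<^bsub>R\<^esub> c (i, i2) \<otimes>\<^bsub>R\<^esub> c (i, i1) =
     c (i1, i) \<otimes>\<^bsub>R\<^esub> inv\<^bsub>R\<^esub> c (i2, i) \<otimes>\<^bsub>R\<^esub> c (i2, i1)"

definition local_exchange_relations ::
    "('a, 'b) ring_scheme \<Rightarrow> (nat \<times> nat \<Rightarrow> 'a) \<Rightarrow> nat \<Rightarrow> nat \<Rightarrow> nat \<Rightarrow> nat \<Rightarrow> bool" where
  "local_exchange_relations R c i i1 j j1 \<longleftrightarrow>
     c (j, i) = c (j, j1) \<otimes>\<^bsub>R\<^esub> inv\<^bsub>R\<^esub> c (i1, j1) \<otimes>\<^bsub>R\<^esub> c (i1, i)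
       \<oplus>\<^bsub>R\<^esub> c (j, i1) \<otimes>\<^bsub>R\<^esub> inv\<^bsub>R\<^esub> c (j1, i1) \<otimes>\<^bsub>R\<^esub> c (j1, i) \<and>
     c (i, j) = c (i, i1) \<otimes>\<^bsub>R\<^esub> inv\<^bsub>R\<^esub> c (j1, i1) \<otimes>\<^bsub>R\<^esub> c (j1, j)
       \<oplus>\<^bsub>R\<^esub> c (i, j1) \<otimes>\<^bsub>R\<^esub> inv\<^bsub>R\<^esub> c (i1, j1) \<otimes>\<^bsub>R\<^esub> c (i1, j) \<and>
     c (i1, j1) = c (i1, i) \<otimes>\<^bsub>R\<^esub> inv\<^bsub>R\<^esub> c (j, i) \<otimes>\<^bsub>R\<^esub> c (j, j1)
       \<oplus>\<^bsub>R\<^esub> c (i1, j) \<otimes>\<^bsub>R\<^esub> inv\<^bsub>R\<^esub> c (i, j) \<otimes>\<^bsub>R\<^esub> c (i, j1) \<and>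
     c (j1, i1) = c (j1, j) \<otimes>\<^bsub>R\<^esub> inv\<^bsub>R\<^esub> c (i, j) \<otimes>\<^bsub>R\<^esub> c (i, i1)
       \<oplus>\<^bsub>R\<^esub> c (j1, i) \<otimes>\<^bsub>R\<^esub> inv\<^bsub>R\<^esub> c (j, i) \<otimes>\<^bsub>R\<^esub> c (j, i1)"

definition noncommutative_frieze ::
    "('a, 'b) ring_scheme \<Rightarrow> nat \<Rightarrow> (nat \<times> nat \<Rightarrow> 'a) \<Rightarrow> bool" where
  "noncommutative_frieze R m c \<longleftrightarrow>
     c \<in> diag m \<rightarrow> Units R \<and>
     (\<forall>i<m. local_triangle_relation R c i ((i + 1) mod m) ((i + 2) mod m)) \<and>
     (\<forall>i<m. \<forall>j<m. distinct [i, (i + 1) mod m, j, (j + 1) mod m] \<longrightarrow>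
        local_exchange_relations R c i ((i + 1) mod m) j ((j + 1) mod m))"

text \<open>For four distinct vertices, \<open>(i, k)\<close> and \<open>(j, l)\<close> are the crossing diagonals of the
  quadrangle they span iff the line through \<open>i\<close> and \<open>k\<close> separates \<open>j\<close> from \<open>l\<close>, i.e. exactly
  one of \<open>j\<close>, \<open>l\<close> has its number between those of \<open>i\<close> and \<open>k\<close>.\<close>

definition crossing :: "nat \<Rightarrow> nat \<Rightarrow> nat \<Rightarrow> nat \<Rightarrow> bool" where
  "crossing i k j l \<longleftrightarrow> distinct [i, j, k, l] \<and>
     (j \<in> {min i k<..<max i k}) \<noteq> (l \<in> {min i k<..<max i k})"

end

theory Submission imports Defs begin

text \<open>Replace \<open>c (i, j)\<close> by \<open>- c (i, j)\<close> whenever \<open>i > j\<close>, and put \<open>0\<close> on the diagonal. In the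
  commutative case the matrix \<open>x\<close> so obtained is the matrix of the \<open>2 \<times> 2\<close> determinants
  \<open>det (v\<^sub>i, v\<^sub>j)\<close> of vectors in a plane. For this \<open>x\<close> the two families of
  relations are instances of a single one,

    \<open>x a b = x a p (x q p)\<^bsup>-1\<^esup> x q b + x a q (x p q)\<^bsup>-1\<^esup> x p b\<close>,

  which no longer refers to the cyclic position of the four indices: for distinct \<open>a, b, p, q\<close>
  with crossing diagonals \<open>a b\<close> and \<open>p q\<close> it is an exchange relation, and for \<open>a = b\<close>, where the
  left-hand side vanishes, it is the triangle relation. It says that row \<open>a\<close> is the combination
  of the rows \<open>p\<close> and \<open>q\<close> forced by the columns \<open>p\<close> and \<open>q\<close>, so that \<open>x\<close> has rank \<open>2\<close>.

  The relation for one pair \<open>p, q\<close> and all \<open>a, b\<close> implies it for every other pair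
  (\<open>spanning_pair_change\<close>). A direct change of basis would pass from a one-sided to a two-sided
  inverse of a \<open>2 \<times> 2\<close> matrix, which fails over general rings; replacing one of
  the two indices at a time only inverts entries of \<open>x\<close>.

  It remains to find one spanning pair. This is done for the vertices \<open>s, \<dots>, t\<close> by induction
  on \<open>t - s\<close> (\<open>spanning_pair_if_local\<close>). By induction \<open>s + 1, t - 1\<close> spans both
  \<open>{s..t - 1}\<close> and \<open>{s + 1..t}\<close>, so that only the two entries at \<open>(s, t)\<close> and \<open>(t, s)\<close>
  remain, and these are determined by the local exchange relations of the quadrangle
  \<open>s, s + 1, t - 1, t\<close>.\<close>

section \<open>Matrices of rank two over a ring\<close>

definition plucker_relation ::
    "('a, 'b) ring_scheme \<Rightarrow> ('i \<Rightarrow> 'i \<Rightarrow> 'a) \<Rightarrow> 'i \<Rightarrow> 'i \<Rightarrow> 'i \<Rightarrow> 'i \<Rightarrow> bool" where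
  "plucker_relation R x p q a b \<longleftrightarrow>
     x a b = x a p \<otimes>\<^bsub>R\<^esub> inv\<^bsub>R\<^esub> x q p \<otimes>\<^bsub>R\<^esub> x q b \<oplus>\<^bsub>R\<^esub> x a q \<otimes>\<^bsub>R\<^esub> inv\<^bsub>R\<^esub> x p q \<otimes>\<^bsub>R\<^esub> x p b"

text \<open>The requirement covers \<open>a = b\<close> too; this is how it carries the triangle relations.\<close>

definition spanning_pair ::
    "('a, 'b) ring_scheme \<Rightarrow> ('i \<Rightarrow> 'i \<Rightarrow> 'a) \<Rightarrow> 'i set \<Rightarrow> 'i \<Rightarrow> 'i \<Rightarrow> bool" where
  "spanning_pair R x S p q \<longleftrightarrow> (\<forall>a\<in>S. \<forall>b\<in>S. plucker_relation R x p q a b)"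

definition hollow_unit_matrix ::
    "('a, 'b) ring_scheme \<Rightarrow> ('i \<Rightarrow> 'i \<Rightarrow> 'a) \<Rightarrow> 'i set \<Rightarrow> bool" where
  "hollow_unit_matrix R x S \<longleftrightarrow>
     (\<forall>a\<in>S. x a a = \<zero>\<^bsub>R\<^esub>) \<and> (\<forall>a\<in>S. \<forall>b\<in>S. a \<noteq> b \<longrightarrow> x a b \<in> Units R)"

text \<open>The sign makes the case distinction between crossing and non-crossing diagonals disappear
  from the exchange relations.\<close>

definition signed_matrix ::
    "('a, 'b) ring_scheme \<Rightarrow> (nat \<times> nat \<Rightarrow> 'a) \<Rightarrow> nat \<Rightarrow> nat \<Rightarrow> 'a" where
  "signed_matrix R c i j = (if i = j then \<zero>\<^bsub>R\<^esub> else if i < j then c (i, j) else \<ominus>\<^bsub>R\<^esub> c (i, j))"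

lemma (in ring)
  assumes "u \<in> Units R"
  shows minus_Units_closed: "\<ominus> u \<in> Units R"
    and inv_minus: "inv (\<ominus> u) = \<ominus> (inv u)"
proof -
  have u: "u \<in> carrier R" "inv u \<in> carrier R" using assms by auto
  have 1: "\<ominus> (inv u) \<otimes> \<ominus> u = \<one>" "\<ominus> u \<otimes> \<ominus> (inv u) = \<one>"
    using u assms by (simp_all add: l_minus r_minus)
  then show "\<ominus> u \<in> Units R"
    unfolding Units_def using u by auto
  show "inv (\<ominus> u) = \<ominus> (inv u)"
    using 1 u inv_char[of "\<ominus> u" "\<ominus> (inv u)"] by simp
qed

lemma hollow_unit_matrix_subset:
  "hollow_unit_matrix R x T \<Longrightarrow> S \<subseteq> T \<Longrightarrow> hollow_unit_matrix R x S"
  unfolding hollow_unit_matrix_def by blast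

context ring
begin

lemma hollow_unit_matrix_carrier:
  "hollow_unit_matrix R x S \<Longrightarrow> a \<in> S \<Longrightarrow> b \<in> S \<Longrightarrow> x a b \<in> carrier R"
  unfolding hollow_unit_matrix_def by (cases "a = b") auto

lemma plucker_relation_swap:
  assumes "hollow_unit_matrix R x S" "{p, q, a, b} \<subseteq> S" "p \<noteq> q"
  shows "plucker_relation R x p q a b \<longleftrightarrow> plucker_relation R x q p a b"
proof -
  have [simp]: "x y z \<in> carrier R" if "y \<in> {p, q, a, b}" "z \<in> {p, q, a, b}" for y z
    using assms that hollow_unit_matrix_carrier[of x S y z] by blast
  have [simp]: "inv x p q \<in> carrier R" "inv x q p \<in> carrier R"
    using assms unfolding hollow_unit_matrix_def by auto
  show ?thesis unfolding plucker_relation_def by (simp add: a_comm)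
qed

lemma spanning_pair_swap:
  assumes "hollow_unit_matrix R x S" "p \<in> S" "q \<in> S" "p \<noteq> q" "spanning_pair R x S p q"
  shows "spanning_pair R x S q p"
  using assms plucker_relation_swap[of x S p q] unfolding spanning_pair_def by simp

lemma spanning_pair_self:
  assumes "hollow_unit_matrix R x {p, q}" "p \<noteq> q"
  shows "spanning_pair R x {p, q} p q"
  using assms unfolding spanning_pair_def plucker_relation_def hollow_unit_matrix_def
  by (auto simp: m_assoc)

lemma Units_cancel:
  assumes "u \<in> Units R" "y \<in> carrier R"
  shows "inv u \<otimes> (u \<otimes> y) = y" and "u \<otimes> (inv u \<otimes> y) = y"
  using assms by (simp_all add: Units_closed flip: m_assoc)

text \<open>The relation for the pair \<open>s, q\<close> at \<open>(p, t)\<close> contains \<open>x s t\<close> with an invertible left factor.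
  Solving for \<open>x s t\<close> produces the product \<open>x s q (x p q)\<^bsup>-1\<^esup> x p s\<close>, which the triangle
  relation for \<open>s, p, q\<close> turns into \<open>- x s p (x q p)\<^bsup>-1\<^esup> x q s\<close>.\<close>

lemma plucker_relation_outer_row:
  assumes x: "hollow_unit_matrix R x {p, q, s, t}" and d: "distinct [p, q, s]"
    and e: "plucker_relation R x s q p t" and ss: "plucker_relation R x p q s s"
  shows "plucker_relation R x p q s t"
proof -
  have [simp]: "x y z \<in> carrier R" if "y \<in> {p, q, s, t}" "z \<in> {p, q, s, t}" for y z
    using x that by (rule hollow_unit_matrix_carrier)
  have [simp]: "x p q \<in> Units R" "x q p \<in> Units R" "x p s \<in> Units R" "x s p \<in> Units R"
      "x q s \<in> Units R" "x s q \<in> Units R"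
    using x d unfolding hollow_unit_matrix_def by auto
  have 0: "\<zero> = x s p \<otimes> inv x q p \<otimes> x q s \<oplus> x s q \<otimes> inv x p q \<otimes> x p s"
    using x ss unfolding plucker_relation_def hollow_unit_matrix_def by simp
  then have 1: "x s q \<otimes> inv x p q \<otimes> x p s = \<ominus> (x s p \<otimes> inv x q p \<otimes> x q s)"
    using d by (intro minus_equality[symmetric]) (auto simp: a_comm)
  have "x s q \<otimes> inv x p q \<otimes> x p t
      = (x s q \<otimes> inv x p q \<otimes> x p s) \<otimes> inv x q s \<otimes> x q t \<oplus> x s t"
    using e unfolding plucker_relation_def by (simp add: r_distr m_assoc Units_cancel a_comm)
  also have "\<dots> = \<ominus> (x s p \<otimes> inv x q p \<otimes> x q t) \<oplus> x s t"
    unfolding 1 by (simp add: l_minus m_assoc Units_cancel)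
  finally show ?thesis
    unfolding plucker_relation_def by (simp add: r_neg1 r_neg2)
qed

text \<open>The transposed statement: it is the previous one over the opposite ring.\<close>

lemma plucker_relation_outer_column:
  assumes x: "hollow_unit_matrix R x {p, q, s, t}" and d: "distinct [p, q, s]"
    and e: "plucker_relation R x s q t p" and ss: "plucker_relation R x p q s s"
  shows "plucker_relation R x p q t s"
proof -
  have [simp]: "x y z \<in> carrier R" if "y \<in> {p, q, s, t}" "z \<in> {p, q, s, t}" for y z
    using x that by (rule hollow_unit_matrix_carrier)
  have [simp]: "x p q \<in> Units R" "x q p \<in> Units R" "x p s \<in> Units R" "x s p \<in> Units R"
      "x q s \<in> Units R" "x s q \<in> Units R"
    using x d unfolding hollow_unit_matrix_def by auto
  have 0: "\<zero> = x s p \<otimes> inv x q p \<otimes> x q s \<oplus> x s q \<otimes> inv x p q \<otimes> x p s"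
    using x ss unfolding plucker_relation_def hollow_unit_matrix_def by simp
  then have 1: "x s p \<otimes> inv x q p \<otimes> x q s = \<ominus> (x s q \<otimes> inv x p q \<otimes> x p s)"
    using d by (intro minus_equality[symmetric]) auto
  have "x t p \<otimes> inv x q p \<otimes> x q s
      = x t s \<oplus> x t q \<otimes> inv x s q \<otimes> (x s p \<otimes> inv x q p \<otimes> x q s)"
    using e unfolding plucker_relation_def by (simp add: l_distr m_assoc Units_cancel a_comm)
  also have "\<dots> = x t s \<oplus> \<ominus> (x t q \<otimes> inv x p q \<otimes> x p s)"
    unfolding 1 by (simp add: r_minus m_assoc Units_cancel)
  finally show ?thesis
    unfolding plucker_relation_def by (simp add: a_assoc l_neg)
qed

text \<open>In the relation for the pair \<open>p, q\<close>, row \<open>r\<close> expresses the part \<open>(x q p)\<^bsup>-1\<^esup> x q b\<close>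
  through \<open>x r b\<close>, and column \<open>r\<close> expresses \<open>x a q (x p q)\<^bsup>-1\<^esup>\<close> through \<open>x a r\<close>. Substituting
  both leaves two correction terms, which cancel by the triangle relation for \<open>p, q, r\<close>.\<close>

lemma spanning_pair_replace:
  assumes x: "hollow_unit_matrix R x S" and S: "p \<in> S" "q \<in> S" "r \<in> S"
    and d: "p \<noteq> q" "r \<noteq> p" and sp: "spanning_pair R x S p q"
  shows "spanning_pair R x S p r"
  unfolding spanning_pair_def plucker_relation_def
proof (intro ballI)
  fix a b assume ab: "a \<in> S" "b \<in> S"
  have [simp]: "x y z \<in> carrier R" if "y \<in> {p, q, r, a, b}" "z \<in> {p, q, r, a, b}" for y z
    using x by (rule hollow_unit_matrix_carrier) (use that S ab in auto)
  have [simp]: "x p q \<in> Units R" "x q p \<in> Units R" "x r p \<in> Units R" "x p r \<in> Units R"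
    using x S d unfolding hollow_unit_matrix_def by simp_all
  let ?u = "inv x q p" and ?v = "inv x p q"
  have eq: "x y z = x y p \<otimes> ?u \<otimes> x q z \<oplus> x y q \<otimes> ?v \<otimes> x p z" if "y \<in> S" "z \<in> S" for y z
    using sp that unfolding spanning_pair_def plucker_relation_def by blast
  \<comment> \<open>the triangle relation at \<open>r\<close>, to be divided by \<open>x r p\<close> on the left and \<open>x p r\<close> on the right\<close>
  have "x r p \<otimes> ?u \<otimes> x q r \<oplus> x r q \<otimes> ?v \<otimes> x p r = \<zero>"
    using eq[of r r] S x unfolding hollow_unit_matrix_def by simp
  then have "x r q \<otimes> ?v \<otimes> x p r = \<ominus> (x r p \<otimes> ?u \<otimes> x q r)"
    by (intro minus_equality[symmetric]) (auto simp: a_comm)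
  then have "inv x r p \<otimes> (x r q \<otimes> ?v \<otimes> x p r) \<otimes> inv x p r
      = inv x r p \<otimes> (\<ominus> (x r p \<otimes> ?u \<otimes> x q r)) \<otimes> inv x p r" by simp
  moreover have "inv x r p \<otimes> (x r q \<otimes> ?v \<otimes> x p r) \<otimes> inv x p r
      = inv x r p \<otimes> x r q \<otimes> ?v"
    by (simp add: m_assoc)
  moreover have "inv x r p \<otimes> (\<ominus> (x r p \<otimes> ?u \<otimes> x q r)) \<otimes> inv x p r
      = \<ominus> (?u \<otimes> x q r \<otimes> inv x p r)"
    by (simp add: m_assoc l_minus r_minus Units_cancel)
  ultimately have tri: "inv x r p \<otimes> x r q \<otimes> ?v = \<ominus> (?u \<otimes> x q r \<otimes> inv x p r)" by simp
  have row: "x a p \<otimes> inv x r p \<otimes> x r b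
      = x a p \<otimes> ?u \<otimes> x q b \<oplus> x a p \<otimes> (inv x r p \<otimes> x r q \<otimes> ?v) \<otimes> x p b"
    by (subst eq[OF \<open>r \<in> S\<close> \<open>b \<in> S\<close>])
      (simp add: r_distr m_assoc Units_cancel)
  have col: "x a r \<otimes> inv x p r \<otimes> x p b
      = x a p \<otimes> (?u \<otimes> x q r \<otimes> inv x p r) \<otimes> x p b \<oplus> x a q \<otimes> ?v \<otimes> x p b"
    by (subst eq[OF \<open>a \<in> S\<close> \<open>r \<in> S\<close>])
      (simp add: l_distr m_assoc Units_cancel)
  show "x a b = x a p \<otimes> inv x r p \<otimes> x r b \<oplus> x a r \<otimes> inv x p r \<otimes> x p b"
    unfolding row col tri by (subst eq[OF ab]) (simp add: l_minus r_minus a_assoc r_neg1)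
qed

lemma spanning_pair_change:
  assumes x: "hollow_unit_matrix R x S" and S: "{p, q, u, v} \<subseteq> S"
    and d: "p \<noteq> q" "u \<noteq> v" and sp: "spanning_pair R x S p q"
  shows "spanning_pair R x S u v"
proof -
  have replace: "spanning_pair R x S y w"
    if "spanning_pair R x S y z" "y \<in> S" "z \<in> S" "w \<in> S" "y \<noteq> z" "w \<noteq> y" for y z w
    using that spanning_pair_replace[OF x] by blast
  have swap: "spanning_pair R x S z y"
    if "spanning_pair R x S y z" "y \<in> S" "z \<in> S" "y \<noteq> z" for y z
    using that spanning_pair_swap[OF x] by blast
  show ?thesis
  proof (cases "v = p")
    case True
    then show ?thesis using replace[of p q u] swap[of p u] S d sp by auto
  next
    case False
    then show ?thesis
      using replace[of p q v] swap[of p v] replace[of v p u] swap[of v u] S d sp by auto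
  qed
qed

section \<open>From local relations to rank two\<close>

text \<open>The hypotheses are the local relations that stay inside the interval, so that they are
  inherited by its subintervals. In the inductive step they supply the two corner entries of the
  square matrix on \<open>{s..t}\<close> that lie in neither of the overlapping squares on \<open>{s..t - 1}\<close> and
  \<open>{s + 1..t}\<close>.\<close>

lemma spanning_pair_if_local:
  fixes x :: "nat \<Rightarrow> nat \<Rightarrow> 'a"
  assumes x: "hollow_unit_matrix R x {s..t}"
    and tri: "\<And>i. s \<le> i \<Longrightarrow> i + 2 \<le> t \<Longrightarrow> plucker_relation R x i (i + 2) (i + 1) (i + 1)"
    and row: "\<And>i j. s \<le> i \<Longrightarrow> i + 1 < j \<Longrightarrow> j + 1 \<le> t \<Longrightarrow> plucker_relation R x i j (i + 1) (j + 1)"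
    and col: "\<And>i j. s \<le> i \<Longrightarrow> i + 1 < j \<Longrightarrow> j + 1 \<le> t \<Longrightarrow> plucker_relation R x i j (j + 1) (i + 1)"
    and uv: "u \<in> {s..t}" "v \<in> {s..t}" "u \<noteq> v"
  shows "spanning_pair R x {s..t} u v"
  using assms
proof (induction "t - s" arbitrary: s t u v rule: less_induct)
  case less
  note x = less.prems(1)
  consider "t = s + 1" | "t = s + 2" | "s + 3 \<le> t" using less.prems(5-7) by fastforce
  then obtain p q where "p \<in> {s..t}" "q \<in> {s..t}" "p \<noteq> q" "spanning_pair R x {s..t} p q"
  proof cases
    case 1
    then have "{s..t} = {s, t}" by auto
    with 1 that[of s t] x show ?thesis using spanning_pair_self[of x s t] by auto
  next
    case 2
    then have S: "{s..t} = {s, s + 1, t}" by auto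
    have "plucker_relation R x s t (s + 1) (s + 1)" using less.prems(2)[of s] 2 by simp
    moreover have "x (s + 1) s \<in> carrier R" "x s (s + 1) \<in> carrier R"
       "x (s + 1) t \<in> carrier R" "x t (s + 1) \<in> carrier R"
      using hollow_unit_matrix_carrier[OF x] 2 by simp_all
    moreover have "x s t \<in> Units R" "x t s \<in> Units R" "x s s = \<zero>" "x t t = \<zero>"
      using x 2 unfolding hollow_unit_matrix_def by simp_all
    ultimately have "spanning_pair R x {s..t} s t"
      unfolding S spanning_pair_def by (auto simp: plucker_relation_def m_assoc Units_closed)
    with 2 that[of s t] show ?thesis by auto
  next
    case 3
    \<comment> \<open>this pair lies in both subintervals, and its two members differ because \<open>t \<ge> s + 3\<close>\<close>
    let ?p = "s + 1" and ?q = "t - 1"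
    have L: "spanning_pair R x {s..t - 1} ?p ?q"
      using 3 less.prems(2-4) by (intro less.hyps hollow_unit_matrix_subset[OF x]) auto
    have R: "spanning_pair R x {s + 1..t} ?p ?q"
      using 3 less.prems(2-4) by (intro less.hyps hollow_unit_matrix_subset[OF x]) auto
    have x4: "hollow_unit_matrix R x {?p, ?q, s, t}"
      using 3 by (intro hollow_unit_matrix_subset[OF x]) auto
    have d: "distinct [?p, ?q, s]" using 3 by auto
    have ss: "plucker_relation R x ?p ?q s s" using L 3 unfolding spanning_pair_def by simp
    have st: "plucker_relation R x ?p ?q s t"
      using less.prems(3)[of s ?q] 3 by (intro plucker_relation_outer_row[OF x4 d _ ss]) auto
    have ts: "plucker_relation R x ?p ?q t s"
      using less.prems(4)[of s ?q] 3 by (intro plucker_relation_outer_column[OF x4 d _ ss]) auto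
    have "plucker_relation R x ?p ?q a b" if "a \<in> {s..t}" "b \<in> {s..t}" for a b
    proof -
      have "a \<le> t - 1 \<and> b \<le> t - 1 \<or> s + 1 \<le> a \<and> s + 1 \<le> b \<or> a = s \<and> b = t \<or> a = t \<and> b = s"
        using that by auto
      then show ?thesis using that L R st ts unfolding spanning_pair_def by (elim disjE) auto
    qed
    with 3 that[of ?p ?q] show ?thesis unfolding spanning_pair_def by auto
  qed
  then show ?case using spanning_pair_change[OF x, of p q u v] less.prems(5-7) by simp
qed

section \<open>Noncommutative friezes\<close>

lemma spanning_pair_signed_matrix:
  assumes f: "noncommutative_frieze R m c" and uv: "u < m" "v < m" "u \<noteq> v"
  shows "spanning_pair R (signed_matrix R c) {..<m} u v"
proof -
  have c: "c (i, j) \<in> Units R" if "i < m" "j < m" "i \<noteq> j" for i j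
    using f that unfolding noncommutative_frieze_def diag_def by auto
  have cc: "c (i, j) \<in> carrier R" "inv c (i, j) \<in> carrier R" if "i < m" "j < m" "i \<noteq> j" for i j
    using c[OF that] by auto
  note [simp] = signed_matrix_def inv_minus minus_Units_closed l_minus r_minus
  have m: "{..<m} = {0..m - 1}" using uv by auto
  show ?thesis
    unfolding m
  proof (rule spanning_pair_if_local)
    show "hollow_unit_matrix R (signed_matrix R c) {0..m - 1}"
      using c uv unfolding hollow_unit_matrix_def by simp
  next
    fix i assume i: "i + 2 \<le> m - 1"
    have "local_triangle_relation R c i (i + 1) (i + 2)"
      using f i unfolding noncommutative_frieze_def
      by (auto dest!: spec[of _ i])
    then show "plucker_relation R (signed_matrix R c) i (i + 2) (i + 1) (i + 1)"
      using i c cc unfolding plucker_relation_def local_triangle_relation_def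
      by (simp add: r_neg l_neg)
  next
    fix i j assume i: "i + 1 < j" "j + 1 \<le> m - 1"
    then have "i < m" "j < m" "distinct [i, (i + 1) mod m, j, (j + 1) mod m]"
      and [simp]: "(i + 1) mod m = i + 1" "(j + 1) mod m = j + 1" by auto
    then have e: "local_exchange_relations R c i (i + 1) j (j + 1)"
      using f unfolding noncommutative_frieze_def by metis
    have "c (i + 1, j + 1) = c (i + 1, i) \<otimes> inv c (j, i) \<otimes> c (j, j + 1)
        \<oplus> c (i + 1, j) \<otimes> inv c (i, j) \<otimes> c (i, j + 1)"
      using e unfolding local_exchange_relations_def by blast
    then show "plucker_relation R (signed_matrix R c) i j (i + 1) (j + 1)"
      using i c cc unfolding plucker_relation_def by simp
    have "c (j + 1, i + 1) = c (j + 1, j) \<otimes> inv c (i, j) \<otimes> c (i, i + 1)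
        \<oplus> c (j + 1, i) \<otimes> inv c (j, i) \<otimes> c (j, i + 1)"
      using e unfolding local_exchange_relations_def by blast
    then show "plucker_relation R (signed_matrix R c) i j (j + 1) (i + 1)"
      using i c cc unfolding plucker_relation_def by (simp add: minus_add a_comm)
  qed (use uv in auto)
qed

end

text \<open>It remains to remove the signs. In the triangle relation the two products are exchanged by
  reversing three diagonals, so that their signs are opposite whatever the order of the vertices.
  In the exchange relation the three terms have equal signs precisely because the diagonals
  cross.\<close>

theorem theorem7p1:
  fixes R (structure) and m :: nat and c :: "nat \<times> nat \<Rightarrow> 'a"
  assumes "ring R"
    and "m \<ge> 3"
    and "noncommutative_frieze R m c"
  shows "(\<forall>i<m. \<forall>j<m. \<forall>k<m. distinct [i, j, k] \<longrightarrow>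
            c (i, j) \<otimes> inv c (k, j) \<otimes> c (k, i) = c (i, k) \<otimes> inv c (j, k) \<otimes> c (j, i)) \<and>
         (\<forall>i<m. \<forall>j<m. \<forall>k<m. \<forall>l<m. crossing i k j l \<longrightarrow>
            c (k, i) = c (k, l) \<otimes> inv c (j, l) \<otimes> c (j, i)
                     \<oplus> c (k, j) \<otimes> inv c (l, j) \<otimes> c (l, i))"
proof -
  interpret ring R by fact
  have c: "c (i, j) \<in> Units R" if "i < m" "j < m" "i \<noteq> j" for i j
    using assms(3) that unfolding noncommutative_frieze_def diag_def by auto
  have cc: "c (i, j) \<in> carrier R" "inv c (i, j) \<in> carrier R" if "i < m" "j < m" "i \<noteq> j" for i j
    using c[OF that] by auto
  note signed [simp] = signed_matrix_def inv_minus minus_Units_closed l_minus r_minus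
  have plucker: "plucker_relation R (signed_matrix R c) p q a b"
    if "p < m" "q < m" "a < m" "b < m" "p \<noteq> q" for p q a b
    using spanning_pair_signed_matrix[OF assms(3), of p q] that unfolding spanning_pair_def by auto
  show ?thesis
  proof (intro conjI allI impI)
    fix i j k assume v: "i < m" "j < m" "k < m" "distinct [i, j, k]"
    let ?a = "c (i, j) \<otimes> inv c (k, j) \<otimes> c (k, i)" and ?b = "c (i, k) \<otimes> inv c (j, k) \<otimes> c (j, i)"
    have ab: "?a \<in> carrier R" "?b \<in> carrier R" using v cc by simp_all
    have "\<zero> = \<ominus> ?a \<oplus> ?b \<or> \<zero> = ?a \<oplus> \<ominus> ?b"
    proof -
      consider "i < j \<and> j < k" | "i < k \<and> k < j" | "j < i \<and> i < k"
        | "j < k \<and> k < i" | "k < i \<and> i < j" | "k < j \<and> j < i"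
        using v(4) by fastforce
      then show ?thesis
        using plucker[of j k i i] v c cc unfolding plucker_relation_def by cases simp_all
    qed
    then show "?a = ?b"
      using minus_equality[of ?b "\<ominus> ?a"] minus_equality[of ?a "\<ominus> ?b"]
        a_comm[of "\<ominus> ?a" ?b] ab by (elim disjE) simp_all
  next
    fix i j k l assume v: "i < m" "j < m" "k < m" "l < m" and cr: "crossing i k j l"
    let ?a = "c (k, l) \<otimes> inv c (j, l) \<otimes> c (j, i)" and ?b = "c (k, j) \<otimes> inv c (l, j) \<otimes> c (l, i)"
    have d: "distinct [i, j, k, l]" using cr unfolding crossing_def by simp
    have ab: "?a \<in> carrier R" "?b \<in> carrier R" using v d cc by simp_all
    have "c (k, i) = ?a \<oplus> ?b \<or> \<ominus> c (k, i) = \<ominus> ?a \<oplus> \<ominus> ?b"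
    proof -
      consider "i < j" "j < k" "l < i \<or> k < l" | "i < l" "l < k" "j < i \<or> k < j"
        | "k < j" "j < i" "l < k \<or> i < l" | "k < l" "l < i" "j < k \<or> i < j"
      proof (cases "i < k")
        case True
        with cr have "i < j \<and> j < k \<and> (l < i \<or> k < l) \<or> i < l \<and> l < k \<and> (j < i \<or> k < j)"
          unfolding crossing_def by auto
        with that show ?thesis by blast
      next
        case False
        with cr have "k < j \<and> j < i \<and> (l < k \<or> i < l) \<or> k < l \<and> l < i \<and> (j < k \<or> i < j)"
          unfolding crossing_def by auto
        with that show ?thesis by blast
      qed
      then show ?thesis
        using plucker[of l j k i] v c cc unfolding plucker_relation_def
        by cases (elim disjE; simp)+
    qed
    moreover have "\<ominus> ?a \<oplus> \<ominus> ?b = \<ominus> (?a \<oplus> ?b)"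
      using ab by (simp add: minus_add)
    moreover have "c (k, i) \<in> carrier R" "?a \<oplus> ?b \<in> carrier R"
      using ab v d cc by simp_all
    ultimately show "c (k, i) = ?a \<oplus> ?b"
      using minus_minus by metis
  qed
qed

end
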